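(* Let $S_1,\dots,S_m\subseteq N$. Then the subgroup $\bigcap_{i=1}^m Q_{S_i}$ of $P_n$ is generated by the set of monic commutators $x$ such that $\sigma(x)\cap S_i\neq\emptyset$ for all $1\le i\le m$.
   Context: $P_n$ denotes the pure braid group on $n$ strands, generated by elements $p_{a,b}$ for $1\le a<b\le n$ subject to the relations: (A) $p_{a,b}p_{a,c}p_{b,c}=p_{a,c}p_{b,c}p_{a,b}=p_{b,c}p_{a,b}p_{a,c}$ for $1\le a<b<c\le n$; (B) $p_{a,b}p_{c,d}=p_{c,d}p_{a,b}$ and $p_{a,d}p_{b,c}=p_{b,c}p_{a,d}$ for $1\le a<b<c<d\le n$; (C) $p_{a,c}p_{b,c}^{-1}p_{b,d}p_{b,c}=p_{b,c}^{-1}p_{b,d}p_{b,c}p_{a,c}$ for $1\le a<b<c<d\le n$. Let $N=\{1,\dots,n\}$. For $S\subseteq N$: $P_S$ is the subgroup generated by the $p_{a,b}$ with $a\in S$ and $b\in S$; $Q_S$ is the subgroup generated by the $p_{a,b}$ with $a\in S$ or $b\in S$. Commutator convention: $[x,y]=x^{-1}y^{-1}xy$. Monic commutators are defined recursively: each $p_{a,b}$ and $p_{a,b}^{-1}$ ($1\le a<b\le n$) is a monic commutator; if $x,y$ are monic commutators and $[x,y]\neq1$, then $[x,y]$ is a monic commutator. The support $\sigma(x)$ of $x\in P_n$ is the intersection of all $S\subseteq N$ such that $x\in P_S$. *)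

theory Defs
  imports "HOL-Algebra.Algebra"
begin

text \<open>The pure braid group P_n, defined by the presentation given in the paper.
  Words are lists of letters (e, a, b); (False, a, b) stands for the generator
  p_{a,b} and (True, a, b) for its inverse.\<close>

type_synonym letter = "bool \<times> nat \<times> nat"
type_synonym word = "letter list"

definition gen :: "nat \<Rightarrow> nat \<Rightarrow> letter" where
  "gen a b = (False, a, b)"

definition geninv :: "nat \<Rightarrow> nat \<Rightarrow> letter" where
  "geninv a b = (True, a, b)"

fun letter_inv :: "letter \<Rightarrow> letter" where
  "letter_inv (e, a, b) = (\<not> e, a, b)"

definition valid_letter :: "nat \<Rightarrow> letter \<Rightarrow> bool" where
  "valid_letter n l = (1 \<le> fst (snd l) \<and> fst (snd l) < snd (snd l) \<and> snd (snd l) \<le> n)"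

definition valid_word :: "nat \<Rightarrow> word \<Rightarrow> bool" where
  "valid_word n w = (\<forall>l \<in> set w. valid_letter n l)"

inductive braid_rel :: "nat \<Rightarrow> word \<Rightarrow> word \<Rightarrow> bool" for n where
  relA1: "\<lbrakk>1 \<le> a; a < b; b < c; c \<le> n\<rbrakk> \<Longrightarrow>
     braid_rel n [gen a b, gen a c, gen b c] [gen a c, gen b c, gen a b]"
| relA2: "\<lbrakk>1 \<le> a; a < b; b < c; c \<le> n\<rbrakk> \<Longrightarrow>
     braid_rel n [gen a c, gen b c, gen a b] [gen b c, gen a b, gen a c]"
| relB1: "\<lbrakk>1 \<le> a; a < b; b < c; c < d; d \<le> n\<rbrakk> \<Longrightarrow>
     braid_rel n [gen a b, gen c d] [gen c d, gen a b]"
| relB2: "\<lbrakk>1 \<le> a; a < b; b < c; c < d; d \<le> n\<rbrakk> \<Longrightarrow>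
     braid_rel n [gen a d, gen b c] [gen b c, gen a d]"
| relC: "\<lbrakk>1 \<le> a; a < b; b < c; c < d; d \<le> n\<rbrakk> \<Longrightarrow>
     braid_rel n [gen a c, geninv b c, gen b d, gen b c]
                 [geninv b c, gen b d, gen b c, gen a c]"

inductive braid_eq :: "nat \<Rightarrow> word \<Rightarrow> word \<Rightarrow> bool" for n where
  refl: "braid_eq n w w"
| sym: "braid_eq n u v \<Longrightarrow> braid_eq n v u"
| trans: "braid_eq n u v \<Longrightarrow> braid_eq n v w \<Longrightarrow> braid_eq n u w"
| cancel: "braid_eq n (u @ [l, letter_inv l] @ v) (u @ v)"
| rel: "braid_rel n r s \<Longrightarrow> braid_eq n (u @ r @ v) (u @ s @ v)"

definition braid_class :: "nat \<Rightarrow> word \<Rightarrow> word set" where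
  "braid_class n w = {w'. valid_word n w' \<and> braid_eq n w w'}"

definition PureBraid :: "nat \<Rightarrow> word set monoid" where
  "PureBraid n = \<lparr> carrier = braid_class n ` {w. valid_word n w},
     monoid.mult = (\<lambda>A B. braid_class n ((SOME w. w \<in> A) @ (SOME w. w \<in> B))),
     monoid.one = braid_class n [] \<rparr>"

definition pgen :: "nat \<Rightarrow> nat \<Rightarrow> nat \<Rightarrow> word set" where
  "pgen n a b = braid_class n [gen a b]"

definition comm :: "nat \<Rightarrow> word set \<Rightarrow> word set \<Rightarrow> word set" where
  "comm n x y = inv\<^bsub>PureBraid n\<^esub> x \<otimes>\<^bsub>PureBraid n\<^esub> inv\<^bsub>PureBraid n\<^esub> y
                 \<otimes>\<^bsub>PureBraid n\<^esub> x \<otimes>\<^bsub>PureBraid n\<^esub> y"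

inductive_set monic :: "nat \<Rightarrow> word set set" for n where
  gen_monic: "\<lbrakk>1 \<le> a; a < b; b \<le> n\<rbrakk> \<Longrightarrow> pgen n a b \<in> monic n"
| inv_monic: "\<lbrakk>1 \<le> a; a < b; b \<le> n\<rbrakk> \<Longrightarrow> inv\<^bsub>PureBraid n\<^esub> (pgen n a b) \<in> monic n"
| comm_monic: "\<lbrakk>x \<in> monic n; y \<in> monic n; comm n x y \<noteq> \<one>\<^bsub>PureBraid n\<^esub>\<rbrakk>
     \<Longrightarrow> comm n x y \<in> monic n"

definition Psub :: "nat \<Rightarrow> nat set \<Rightarrow> word set set" where
  "Psub n S = generate (PureBraid n)
     {pgen n a b | a b. 1 \<le> a \<and> a < b \<and> b \<le> n \<and> a \<in> S \<and> b \<in> S}"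

definition Qsub :: "nat \<Rightarrow> nat set \<Rightarrow> word set set" where
  "Qsub n S = generate (PureBraid n)
     {pgen n a b | a b. 1 \<le> a \<and> a < b \<and> b \<le> n \<and> (a \<in> S \<or> b \<in> S)}"

definition support :: "nat \<Rightarrow> word set \<Rightarrow> nat set" where
  "support n x = \<Inter> {S. S \<subseteq> {1..n} \<and> x \<in> Psub n S}"

end

theory Submission
  imports Defs
begin

text \<open>
  Conjugation by generators shows that every \<open>Q\<^sub>S\<close> is normal, and forgetting the strands in \<open>S\<close> is a
  retraction onto \<open>P\<^bsub>N-S\<^esub>\<close> that kills \<open>Q\<^sub>S\<close>. Hence \<open>P\<^bsub>N-S\<^esub> \<inter> Q\<^sub>S = 1\<close>, a monic commutator lies in
  \<open>Q\<^sub>S\<close> or in \<open>P\<^bsub>N-S\<^esub>\<close>, and its support is disjoint from \<open>S\<close> iff it lies in \<open>P\<^bsub>N-S\<^esub>\<close>.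
  By induction on \<open>m\<close>, an element of the intersection is a product of monic commutators whose
  supports meet \<open>S\<^sub>1, \<dots>, S\<^bsub>m-1\<^esub>\<close>. Using \<open>y z = z y [y, z]\<close>, the factors \<open>z\<close> whose support misses
  \<open>S\<^sub>m\<close> are collected on the left; every new factor \<open>[y, z] \<noteq> 1\<close> still meets all the \<open>S\<^sub>i\<close> that \<open>y\<close>
  meets. The collected product lies in \<open>P\<^bsub>N-S\<^esub> \<inter> Q\<^sub>S\<close> for \<open>S = S\<^sub>m\<close>, so it is trivial.
\<close>

section \<open>Conjugation and normalisers in an arbitrary group\<close>

context group
begin

lemma inv_mult_cancel [simp]:
  assumes "x \<in> carrier G" "y \<in> carrier G"
  shows "inv x \<otimes> (x \<otimes> y) = y" "x \<otimes> (inv x \<otimes> y) = y"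
  using assms by (simp_all flip: m_assoc)

text \<open>Both directions are recorded because a subgroup may be mapped properly into itself by
  one-sided conjugation, so \<open>inv g\<close> would not inherit the property.\<close>

definition conj_in :: "'a \<Rightarrow> 'a \<Rightarrow> 'a set \<Rightarrow> bool" where
  "conj_in g h K \<longleftrightarrow> g \<otimes> h \<otimes> inv g \<in> K \<and> inv g \<otimes> h \<otimes> g \<in> K"

text \<open>For a subset \<open>H\<close> of the carrier this is the normaliser of
  \<open>H\<close>.\<close>

definition conj_stab :: "'a set \<Rightarrow> 'a set" where
  "conj_stab H = {g \<in> carrier G. \<forall>h \<in> H. conj_in g h H}"

text \<open>The shape of relation (A), kept abstract so that each of the three generators can take
  the place of \<open>u\<close> by rotation.\<close>

definition triangle :: "'a \<Rightarrow> 'a \<Rightarrow> 'a \<Rightarrow> bool" where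
  "triangle u v w \<longleftrightarrow> u \<in> carrier G \<and> v \<in> carrier G \<and> w \<in> carrier G \<and>
     u \<otimes> v \<otimes> w = v \<otimes> w \<otimes> u \<and> v \<otimes> w \<otimes> u = w \<otimes> u \<otimes> v"

lemma triangle_rotate: "triangle u v w \<Longrightarrow> triangle v w u"
  by (auto simp: triangle_def)

lemma subgroup_conj:
  assumes "subgroup K G" "g \<in> K" "h \<in> K"
  shows "conj_in g h K"
  using assms by (simp add: conj_in_def subgroup.m_closed subgroup.m_inv_closed)

lemma conj_in_mono: "conj_in g h K \<Longrightarrow> K \<subseteq> L \<Longrightarrow> conj_in g h L"
  by (auto simp: conj_in_def)

text \<open>The common product of the three rotations commutes with \<open>u\<close>,
  \<open>v\<close> and \<open>w\<close>. Hence conjugation by \<open>u\<close> acts on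
  \<open>v\<close> and \<open>w\<close> like conjugation by the inverse of
  \<open>v \<otimes> w\<close>, which lies in \<open>K\<close>.\<close>

lemma conj_in_triangle:
  assumes K: "subgroup K G" and "triangle u v w" and v: "v \<in> K" and w: "w \<in> K"
  shows "conj_in u v K" "conj_in u w K"
proof -
  have carr: "u \<in> carrier G" "v \<in> carrier G" "w \<in> carrier G"
    and uvw: "u \<otimes> (v \<otimes> w) = v \<otimes> (w \<otimes> u)" and vwu: "v \<otimes> (w \<otimes> u) = w \<otimes> (u \<otimes> v)"
    using assms(2) by (auto simp: triangle_def m_assoc)
  have "u \<otimes> v \<otimes> inv u = inv w \<otimes> (w \<otimes> (u \<otimes> v)) \<otimes> inv u"
    using carr by (simp add: m_assoc)
  also have "\<dots> = inv w \<otimes> v \<otimes> w"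
    unfolding vwu [symmetric] using carr by (simp add: m_assoc)
  finally have 1: "u \<otimes> v \<otimes> inv u = inv w \<otimes> v \<otimes> w" .
  have "inv u \<otimes> w \<otimes> u = inv u \<otimes> (w \<otimes> (u \<otimes> v)) \<otimes> inv v"
    using carr by (simp add: m_assoc)
  also have "\<dots> = v \<otimes> w \<otimes> inv v"
    unfolding vwu [symmetric] uvw [symmetric] using carr by (simp add: m_assoc)
  finally have 2: "inv u \<otimes> w \<otimes> u = v \<otimes> w \<otimes> inv v" .
  have "u \<otimes> w \<otimes> inv u = inv (u \<otimes> v \<otimes> inv u) \<otimes> (u \<otimes> (v \<otimes> w) \<otimes> inv u)"
    using carr by (simp add: m_assoc inv_mult_group)
  also have "\<dots> = inv (inv w \<otimes> v \<otimes> w) \<otimes> (v \<otimes> w)"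
    unfolding 1 uvw using carr by (simp add: m_assoc)
  finally have 3: "u \<otimes> w \<otimes> inv u = inv (inv w \<otimes> v \<otimes> w) \<otimes> (v \<otimes> w)" .
  have "inv u \<otimes> v \<otimes> u = inv u \<otimes> (v \<otimes> (w \<otimes> u)) \<otimes> inv (inv u \<otimes> w \<otimes> u)"
    using carr by (simp add: m_assoc inv_mult_group)
  also have "\<dots> = v \<otimes> w \<otimes> inv (v \<otimes> w \<otimes> inv v)"
    unfolding 2 uvw [symmetric] using carr by (simp add: m_assoc)
  finally have 4: "inv u \<otimes> v \<otimes> u = v \<otimes> w \<otimes> inv (v \<otimes> w \<otimes> inv v)" .
  note closed = subgroup.m_closed [OF K] subgroup.m_inv_closed [OF K]
  show "conj_in u v K" "conj_in u w K"
    unfolding conj_in_def 1 2 3 4 by (intro conjI closed v w)+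
qed

lemma conj_in_inv:
  assumes "subgroup K G" "conj_in g h K" "g \<in> carrier G" "h \<in> carrier G"
  shows "conj_in g (inv h) K"
proof -
  have "g \<otimes> inv h \<otimes> inv g = inv (g \<otimes> h \<otimes> inv g)" "inv g \<otimes> inv h \<otimes> g = inv (inv g \<otimes> h \<otimes> g)"
    using assms by (simp_all add: inv_mult_group m_assoc)
  then show ?thesis
    using assms by (simp add: conj_in_def subgroup.m_inv_closed)
qed

lemma conj_in_commute:
  assumes "u \<in> carrier G" "h \<in> carrier G" "h \<in> K" "u \<otimes> h = h \<otimes> u"
  shows "conj_in u h K"
proof -
  have "inv u \<otimes> h \<otimes> u = h"
    using assms by (simp add: m_assoc flip: assms(4))
  moreover have "u \<otimes> h \<otimes> inv u = h"
    unfolding assms(4) using assms by (simp add: m_assoc)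
  ultimately show ?thesis
    using assms by (simp add: conj_in_def)
qed

lemma conj_in_generate:
  assumes K: "subgroup K G" and g: "g \<in> carrier G" and Y: "Y \<subseteq> carrier G"
    and "\<And>y. y \<in> Y \<Longrightarrow> conj_in g y K" and "h \<in> generate G Y"
  shows "conj_in g h K"
  using assms(5)
proof (induction rule: generate.induct)
  case one
  show ?case
    using g K by (simp add: conj_in_def subgroup.one_closed)
next
  case (incl h)
  then show ?case by (rule assms(4))
next
  case (inv h)
  then show ?case
    using Y g by (intro conj_in_inv K assms(4)) auto
next
  case (eng h1 h2)
  then have "h1 \<in> carrier G" "h2 \<in> carrier G"
    using generate_in_carrier [OF Y] by auto
  then have "g \<otimes> (h1 \<otimes> h2) \<otimes> inv g = (g \<otimes> h1 \<otimes> inv g) \<otimes> (g \<otimes> h2 \<otimes> inv g)"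
    "inv g \<otimes> (h1 \<otimes> h2) \<otimes> g = (inv g \<otimes> h1 \<otimes> g) \<otimes> (inv g \<otimes> h2 \<otimes> g)"
    using g by (simp_all add: m_assoc)
  then show ?case
    using eng K by (simp add: conj_in_def subgroup.m_closed)
qed

lemma conj_stab_subgroup:
  assumes "H \<subseteq> carrier G"
  shows "subgroup (conj_stab H) G"
proof
  show "conj_stab H \<subseteq> carrier G"
    by (auto simp: conj_stab_def)
  show "x \<otimes> y \<in> conj_stab H" if x: "x \<in> conj_stab H" and y: "y \<in> conj_stab H" for x y
  proof -
    have [simp]: "x \<in> carrier G" "y \<in> carrier G"
      using x y by (auto simp: conj_stab_def)
    have "conj_in (x \<otimes> y) h H" if h: "h \<in> H" for h
    proof -
      have [simp]: "h \<in> carrier G" using assms h by auto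
      have "y \<otimes> h \<otimes> inv y \<in> H" "inv x \<otimes> h \<otimes> x \<in> H"
        using x y h by (auto simp: conj_stab_def conj_in_def)
      then have "x \<otimes> (y \<otimes> h \<otimes> inv y) \<otimes> inv x \<in> H" "inv y \<otimes> (inv x \<otimes> h \<otimes> x) \<otimes> y \<in> H"
        using x y by (auto simp: conj_stab_def conj_in_def)
      then show ?thesis
        by (simp add: conj_in_def inv_mult_group m_assoc)
    qed
    then show ?thesis by (simp add: conj_stab_def)
  qed
  show "\<one> \<in> conj_stab H"
    using assms by (auto simp: conj_stab_def conj_in_def)
  \<comment> \<open>Replacing \<open>x\<close> by its inverse merely swaps the two halves of
    \<open>conj_in\<close>.\<close>
  show "inv x \<in> conj_stab H" if "x \<in> conj_stab H" for x
    using that by (auto simp: conj_stab_def conj_in_def)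
qed

lemma conj_stab_generateI:
  assumes "Y \<subseteq> carrier G" "g \<in> carrier G" "\<And>y. y \<in> Y \<Longrightarrow> conj_in g y (generate G Y)"
  shows "g \<in> conj_stab (generate G Y)"
  using assms conj_in_generate [OF generate_is_subgroup [OF assms(1)] assms(2,1)]
  by (auto simp: conj_stab_def)

text \<open>Writing \<open>y = t\<inverse> (t y t\<inverse>) t\<close>, conjugation by \<open>v\<close> only moves the outer factors.\<close>

lemma conj_in_crossing:
  assumes H: "H \<subseteq> carrier G" and v: "v \<in> carrier G" and y: "y \<in> H"
    and t: "t \<in> conj_stab H" and vt: "conj_in v t (conj_stab H)"
    and comm: "v \<otimes> (t \<otimes> y \<otimes> inv t) = t \<otimes> y \<otimes> inv t \<otimes> v"
  shows "conj_in v y H"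
proof -
  have [simp]: "v \<in> carrier G" "y \<in> carrier G" "t \<in> carrier G"
    using assms by (auto simp: conj_stab_def)
  define h where "h = t \<otimes> y \<otimes> inv t"
  have h: "h \<in> H" and [simp]: "h \<in> carrier G"
    using t y by (auto simp: h_def conj_stab_def conj_in_def)
  have y_eq: "y = inv t \<otimes> h \<otimes> t"
    by (simp add: h_def m_assoc)
  have "conj_in v h {h}"
    using comm by (intro conj_in_commute) (simp_all flip: h_def)
  then have hv: "v \<otimes> h \<otimes> inv v = h" "inv v \<otimes> h \<otimes> v = h"
    by (auto simp: conj_in_def)
  have "v \<otimes> y \<otimes> inv v = inv (v \<otimes> t \<otimes> inv v) \<otimes> (v \<otimes> h \<otimes> inv v) \<otimes> (v \<otimes> t \<otimes> inv v)"
    "inv v \<otimes> y \<otimes> v = inv (inv v \<otimes> t \<otimes> v) \<otimes> (inv v \<otimes> h \<otimes> v) \<otimes> (inv v \<otimes> t \<otimes> v)"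
    unfolding y_eq by (simp_all add: m_assoc inv_mult_group)
  then show ?thesis
    using vt h unfolding hv by (auto simp: conj_in_def conj_stab_def)
qed

text \<open>This is the collecting process: generators in \<open>P\<close> move to the left past
  those outside \<open>P\<close>, at the price of conjugating the latter. An element thus becomes
  \<open>z \<otimes> y\<close> with \<open>z\<close> in \<open>P\<close> and \<open>y\<close>
  generated by \<open>A - P\<close>; if it lies in \<open>Q\<close>, so does \<open>z\<close>, and
  \<open>z\<close> is trivial.\<close>

lemma generate_Int_complement:
  assumes A: "A \<subseteq> carrier G" and Ainv: "\<And>x. x \<in> A \<Longrightarrow> inv x \<in> A"
    and P: "subgroup P G" and Q: "subgroup Q G" and PQ: "P \<inter> Q \<subseteq> {\<one>}"
    and APQ: "A - P \<subseteq> Q"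
    and conj: "\<And>y z. y \<in> A - P \<Longrightarrow> z \<in> A \<inter> P \<Longrightarrow> inv z \<otimes> y \<otimes> z \<in> generate G (A - P)"
  shows "generate G A \<inter> Q \<subseteq> generate G (A - P)"
proof
  fix x assume x: "x \<in> generate G A \<inter> Q"
  let ?Y = "generate G (A - P)"
  have Y: "A - P \<subseteq> carrier G" using A by auto
  note Ysub = generate_is_subgroup [OF Y]
  \<comment> \<open>\<open>Z\<close> records what a left factor must satisfy: it lies in
    \<open>P\<close> and can be moved past every \<open>y\<close>. Being a subgroup, it also admits
    products of such factors.\<close>
  define Z where "Z = P \<inter> conj_stab ?Y"
  have Z: "subgroup Z G"
    unfolding Z_def by (intro subgroups_Inter_pair P conj_stab_subgroup generate_incl Y)
  have AZ: "z \<in> Z" if "z \<in> A" "z \<in> P" for z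
  proof -
    have "conj_in z y ?Y" if "y \<in> A - P" for y
      \<comment> \<open>The instance at \<open>inv z\<close>, available since \<open>A\<close> and
        \<open>P\<close> are closed under inverses, supplies the other direction of
        conjugation.\<close>
      using conj [of y z] conj [of y "inv z"] that \<open>z \<in> A\<close> \<open>z \<in> P\<close> Ainv [of z] A P
      by (auto simp: conj_in_def subgroup.m_inv_closed)
    then have "z \<in> conj_stab ?Y"
      using conj_stab_generateI [OF Y] \<open>z \<in> A\<close> A by auto
    then show ?thesis using that by (simp add: Z_def)
  qed
  have AZY: "\<exists>z\<in>Z. \<exists>y\<in>?Y. x = z \<otimes> y" if "x \<in> A" for x
  proof (cases "x \<in> P")
    case True
    then show ?thesis
      using AZ [OF that] that A by (intro bexI [of _ x] bexI [of _ \<one>]) (auto intro: generate.one)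
  next
    case False
    then show ?thesis
      using that A subgroup.one_closed [OF Z]
      by (intro bexI [of _ \<one>] bexI [of _ x]) (auto intro: generate.incl)
  qed
  have "\<exists>z\<in>Z. \<exists>y\<in>?Y. x = z \<otimes> y" if "x \<in> generate G A" for x
    using that
  proof (induction rule: generate.induct)
    case one
    show ?case
      using subgroup.one_closed [OF Z] by (intro bexI [of _ \<one>]) (auto intro: generate.one)
  next
    case (incl h)
    then show ?case by (rule AZY)
  next
    case (inv h)
    then show ?case by (intro AZY Ainv)
  next
    case (eng h1 h2)
    then obtain z1 y1 z2 y2 where *: "z1 \<in> Z" "y1 \<in> ?Y" "h1 = z1 \<otimes> y1"
      "z2 \<in> Z" "y2 \<in> ?Y" "h2 = z2 \<otimes> y2" by blast
    have [simp]: "z1 \<in> carrier G" "z2 \<in> carrier G" "y1 \<in> carrier G" "y2 \<in> carrier G"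
      using * subgroup.mem_carrier [OF Z] generate_in_carrier [OF Y] by auto
    \<comment> \<open>Moving \<open>z2\<close> to the left across \<open>y1\<close> conjugates
      \<open>y1\<close>, which stays in \<open>?Y\<close> because \<open>z2\<close> normalises
      \<open>?Y\<close>.\<close>
    have "h1 \<otimes> h2 = (z1 \<otimes> z2) \<otimes> ((inv z2 \<otimes> y1 \<otimes> z2) \<otimes> y2)"
      by (simp add: * m_assoc)
    moreover have "inv z2 \<otimes> y1 \<otimes> z2 \<in> ?Y"
      using * by (auto simp: Z_def conj_stab_def conj_in_def)
    ultimately show ?case
      using * by (intro bexI [of _ "z1 \<otimes> z2"] bexI [of _ "inv z2 \<otimes> y1 \<otimes> z2 \<otimes> y2"])
        (auto intro: subgroup.m_closed [OF Z] generate.eng)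
  qed
  from this [OF IntD1 [OF x]] obtain z y where *: "z \<in> Z" "y \<in> ?Y" "x = z \<otimes> y"
    by blast
  have "z \<in> carrier G" "y \<in> carrier G"
    using * subgroup.mem_carrier [OF Z] generate_in_carrier [OF Y] by auto
  then have "z = x \<otimes> inv y"
    by (simp add: * m_assoc)
  moreover have "y \<in> Q"
    using * generate_subgroup_incl [OF APQ Q] by auto
  ultimately have "z \<in> Q"
    using x Q by (auto intro: subgroup.m_closed subgroup.m_inv_closed)
  then have "z = \<one>"
    using * PQ by (auto simp: Z_def)
  then show "x \<in> ?Y"
    using * \<open>y \<in> carrier G\<close> by simp
qed

end

section \<open>From words to the group given by the presentation\<close>

lemma letter_inv_inv [simp]: "letter_inv (letter_inv l) = l"
  by (cases l) auto

lemma valid_word_simps [simp]: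
  "valid_word n []"
  "valid_word n (l # w) \<longleftrightarrow> valid_letter n l \<and> valid_word n w"
  "valid_word n (u @ v) \<longleftrightarrow> valid_word n u \<and> valid_word n v"
  by (auto simp: valid_word_def)

text \<open>Makes multiplication of classes well defined: the rules \<open>cancel\<close> and
  \<open>rel\<close> already carry a context on both sides, which absorbs the added word.\<close>

lemma braid_eq_append_cong:
  assumes "braid_eq n u u'" "braid_eq n v v'"
  shows "braid_eq n (u @ v) (u' @ v')"
proof -
  have left: "braid_eq n (w @ u) (w @ u')" if "braid_eq n u u'" for w u u'
    using that
  proof (induction rule: braid_eq.induct)
    case (cancel u l v)
    show ?case using braid_eq.cancel [of n "w @ u" l v] by simp
  next
    case (rel r s u v)
    then show ?case using braid_eq.rel [of n r s "w @ u" v] by simp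
  qed (blast intro: braid_eq.intros)+
  have right: "braid_eq n (u @ w) (u' @ w)" if "braid_eq n u u'" for w u u'
    using that
  proof (induction rule: braid_eq.induct)
    case (cancel u l v)
    show ?case using braid_eq.cancel [of n u l "v @ w"] by simp
  next
    case (rel r s u v)
    then show ?case using braid_eq.rel [of n r s u "v @ w"] by simp
  qed (blast intro: braid_eq.intros)+
  show ?thesis
    using left [OF assms(2)] right [OF assms(1)] braid_eq.trans by blast
qed

text \<open>Validity puts \<open>v\<close> into its own class. Classes contain valid words only, so
  two inequivalent invalid words could both have the empty class.\<close>

lemma braid_class_eq_iff:
  assumes "valid_word n v"
  shows "braid_class n u = braid_class n v \<longleftrightarrow> braid_eq n u v"
proof
  assume "braid_class n u = braid_class n v"
  moreover have "v \<in> braid_class n v"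
    using assms by (simp add: braid_class_def braid_eq.refl)
  ultimately show "braid_eq n u v"
    by (auto simp: braid_class_def)
next
  assume "braid_eq n u v"
  then show "braid_class n u = braid_class n v"
    unfolding braid_class_def by (blast intro: braid_eq.sym braid_eq.trans)
qed

lemma braid_class_some:
  assumes "valid_word n w"
  shows "valid_word n (SOME v. v \<in> braid_class n w)"
    and "braid_eq n w (SOME v. v \<in> braid_class n w)"
proof -
  have "w \<in> braid_class n w"
    using assms by (simp add: braid_class_def braid_eq.refl)
  then have "(SOME v. v \<in> braid_class n w) \<in> braid_class n w"
    by (rule someI)
  then show "valid_word n (SOME v. v \<in> braid_class n w)"
    and "braid_eq n w (SOME v. v \<in> braid_class n w)"
    by (auto simp: braid_class_def)
qed

lemma braid_class_carrier: "valid_word n w \<Longrightarrow> braid_class n w \<in> carrier (PureBraid n)"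
  by (simp add: PureBraid_def)

lemma carrier_PureBraidE:
  assumes "x \<in> carrier (PureBraid n)"
  obtains w where "valid_word n w" "x = braid_class n w"
  using assms by (auto simp: PureBraid_def)

lemma braid_class_mult:
  assumes "valid_word n u" "valid_word n v"
  shows "braid_class n u \<otimes>\<^bsub>PureBraid n\<^esub> braid_class n v = braid_class n (u @ v)"
proof -
  have "braid_eq n ((SOME w. w \<in> braid_class n u) @ (SOME w. w \<in> braid_class n v)) (u @ v)"
    using assms by (intro braid_eq_append_cong braid_eq.sym [OF braid_class_some(2)])
  then show ?thesis
    using assms by (simp add: PureBraid_def braid_class_eq_iff)
qed

lemma one_PureBraid: "\<one>\<^bsub>PureBraid n\<^esub> = braid_class n []"
  by (simp add: PureBraid_def)

lemma braid_class_inverse: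
  assumes "valid_word n w"
  shows "\<exists>v. valid_word n v \<and> braid_eq n (v @ w) []"
  using assms
proof (induction w)
  case Nil
  show ?case by (intro exI [of _ "[]"]) (simp add: braid_eq.refl)
next
  case (Cons l w)
  then obtain v where v: "valid_word n v" "braid_eq n (v @ w) []" by auto
  have "valid_letter n (letter_inv l)"
    using Cons.prems by (cases l) (auto simp: valid_letter_def)
  \<comment> \<open>The rule \<open>cancel\<close> removes a letter followed by its inverse, so it
    is applied to \<open>letter_inv l\<close>, whose inverse is \<open>l\<close>.\<close>
  moreover have "braid_eq n (v @ [letter_inv l, letter_inv (letter_inv l)] @ w) (v @ w)"
    by (rule braid_eq.cancel)
  ultimately show ?case
    using v by (intro exI [of _ "v @ [letter_inv l]"]) (auto intro: braid_eq.trans)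
qed

interpretation PB: group "PureBraid n" for n
proof (rule groupI)
  fix x y z assume "x \<in> carrier (PureBraid n)" "y \<in> carrier (PureBraid n)"
    "z \<in> carrier (PureBraid n)"
  then show "x \<otimes>\<^bsub>PureBraid n\<^esub> y \<otimes>\<^bsub>PureBraid n\<^esub> z = x \<otimes>\<^bsub>PureBraid n\<^esub> (y \<otimes>\<^bsub>PureBraid n\<^esub> z)"
    by (auto elim!: carrier_PureBraidE simp: braid_class_mult)
next
  fix x assume "x \<in> carrier (PureBraid n)"
  then obtain w where w: "valid_word n w" "x = braid_class n w"
    by (rule carrier_PureBraidE)
  then obtain v where "valid_word n v" "braid_eq n (v @ w) []"
    using braid_class_inverse by blast
  then show "\<exists>y\<in>carrier (PureBraid n). y \<otimes>\<^bsub>PureBraid n\<^esub> x = \<one>\<^bsub>PureBraid n\<^esub>"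
    using w by (intro bexI [of _ "braid_class n v"])
      (auto simp: braid_class_mult one_PureBraid braid_class_eq_iff braid_class_carrier)
qed (auto elim!: carrier_PureBraidE
     simp: braid_class_mult one_PureBraid braid_class_carrier)

section \<open>Generators and the defining relations as identities in the group\<close>

lemma pgen_carrier: "1 \<le> a \<Longrightarrow> a < b \<Longrightarrow> b \<le> n \<Longrightarrow> pgen n a b \<in> carrier (PureBraid n)"
  unfolding pgen_def gen_def by (intro braid_class_carrier) (simp add: valid_letter_def)

lemma inv_pgen:
  assumes "1 \<le> a" "a < b" "b \<le> n"
  shows "inv\<^bsub>PureBraid n\<^esub> (pgen n a b) = braid_class n [geninv a b]"
proof (rule PB.inv_equality)
  have val: "valid_word n [gen a b]" "valid_word n [geninv a b]"
    using assms by (simp_all add: valid_letter_def gen_def geninv_def)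
  have "braid_eq n ([] @ [geninv a b, letter_inv (geninv a b)] @ []) ([] @ [])"
    by (rule braid_eq.cancel)
  then show "braid_class n [geninv a b] \<otimes>\<^bsub>PureBraid n\<^esub> pgen n a b = \<one>\<^bsub>PureBraid n\<^esub>"
    using val by (simp add: pgen_def braid_class_mult one_PureBraid braid_class_eq_iff)
      (simp add: gen_def geninv_def)
  show "braid_class n [geninv a b] \<in> carrier (PureBraid n)"
    using val(2) by (rule braid_class_carrier)
qed (use assms pgen_carrier in auto)

text \<open>Every class is represented by a word in valid letters, each of which is a generator or
  the inverse of one. Statements about the whole group can thus be checked on generators.\<close>

lemma carrier_subset_Psub: "carrier (PureBraid n) \<subseteq> Psub n {1..n}"
proof
  fix x assume "x \<in> carrier (PureBraid n)"
  then obtain w where "valid_word n w" "x = braid_class n w"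
    by (rule carrier_PureBraidE)
  moreover have "valid_word n w \<Longrightarrow> braid_class n w \<in> Psub n {1..n}" for w
  proof (induction w)
    case Nil
    then show ?case
      by (simp add: Psub_def generate.one flip: one_PureBraid)
  next
    case (Cons l w)
    obtain e a b where l: "l = (e, a, b)" by (cases l)
    have ab: "1 \<le> a" "a < b" "b \<le> n"
      using Cons.prems by (auto simp: l valid_letter_def)
    have p: "pgen n a b \<in> {pgen n a b | a b. 1 \<le> a \<and> a < b \<and> b \<le> n \<and> a \<in> {1..n} \<and> b \<in> {1..n}}"
      using ab by fastforce
    have "braid_class n [l] = pgen n a b \<or> braid_class n [l] = inv\<^bsub>PureBraid n\<^esub> pgen n a b"
      unfolding inv_pgen [OF ab] by (cases e) (simp_all add: pgen_def l gen_def geninv_def)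
    then have "braid_class n [l] \<in> Psub n {1..n}"
      using generate.incl [OF p] generate.inv [OF p] by (auto simp: Psub_def)
    moreover have "braid_class n (l # w) = braid_class n [l] \<otimes>\<^bsub>PureBraid n\<^esub> braid_class n w"
      using Cons.prems by (simp add: braid_class_mult)
    ultimately show ?case
      using Cons by (simp add: Psub_def generate.eng)
  qed
  ultimately show "x \<in> Psub n {1..n}" by simp
qed

lemma braid_class_rel:
  assumes "braid_rel n r s" "valid_word n r" "valid_word n s"
  shows "braid_class n r = braid_class n s"
  using assms braid_eq.rel [of n r s "[]" "[]"] by (simp add: braid_class_eq_iff)

lemma pgen_triangle:
  assumes "1 \<le> a" "a < b" "b < c" "c \<le> n"
  shows "PB.triangle n (pgen n a b) (pgen n a c) (pgen n b c)"
proof -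
  have val: "valid_word n [gen a b]" "valid_word n [gen a c]" "valid_word n [gen b c]"
    using assms by (auto simp: valid_letter_def gen_def)
  show ?thesis
    using braid_class_rel [OF relA1 [OF assms]] braid_class_rel [OF relA2 [OF assms]] val
    by (simp add: PB.triangle_def pgen_def braid_class_mult braid_class_carrier)
qed

lemma pgen_commute:
  assumes "1 \<le> a" "a < b" "b < c" "c < d" "d \<le> n"
  shows "pgen n a b \<otimes>\<^bsub>PureBraid n\<^esub> pgen n c d = pgen n c d \<otimes>\<^bsub>PureBraid n\<^esub> pgen n a b"
    and "pgen n a d \<otimes>\<^bsub>PureBraid n\<^esub> pgen n b c = pgen n b c \<otimes>\<^bsub>PureBraid n\<^esub> pgen n a d"
proof -
  have val: "valid_word n [gen a b]" "valid_word n [gen c d]" "valid_word n [gen a d]"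
    "valid_word n [gen b c]"
    using assms by (auto simp: valid_letter_def gen_def)
  show "pgen n a b \<otimes>\<^bsub>PureBraid n\<^esub> pgen n c d = pgen n c d \<otimes>\<^bsub>PureBraid n\<^esub> pgen n a b"
    and "pgen n a d \<otimes>\<^bsub>PureBraid n\<^esub> pgen n b c = pgen n b c \<otimes>\<^bsub>PureBraid n\<^esub> pgen n a d"
    using braid_class_rel [OF relB1 [OF assms]] braid_class_rel [OF relB2 [OF assms]] val
    by (simp_all add: pgen_def braid_class_mult)
qed

lemma pgen_crossing:
  assumes "1 \<le> a" "a < b" "b < c" "c < d" "d \<le> n"
  defines "q \<equiv> inv\<^bsub>PureBraid n\<^esub> pgen n b c"
  shows "pgen n a c \<otimes>\<^bsub>PureBraid n\<^esub> (q \<otimes>\<^bsub>PureBraid n\<^esub> pgen n b d \<otimes>\<^bsub>PureBraid n\<^esub> pgen n b c)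
    = q \<otimes>\<^bsub>PureBraid n\<^esub> pgen n b d \<otimes>\<^bsub>PureBraid n\<^esub> pgen n b c \<otimes>\<^bsub>PureBraid n\<^esub> pgen n a c"
proof -
  have val: "valid_word n [gen a c]" "valid_word n [geninv b c]" "valid_word n [gen b d]"
    "valid_word n [gen b c]"
    using assms by (auto simp: valid_letter_def gen_def geninv_def)
  have q: "q = braid_class n [geninv b c]"
    using assms unfolding q_def by (intro inv_pgen) auto
  show ?thesis
    using braid_class_rel [OF relC [OF assms(1-5)]] val
    by (simp add: q pgen_def braid_class_mult)
qed


section \<open>Normality of the subgroups \<open>Qsub n S\<close>\<close>

lemma subset_conj_stab:
  assumes "subgroup H (PureBraid n)"
  shows "H \<subseteq> PB.conj_stab n H"
  using assms subgroup.subset [OF assms] by (auto simp: PB.conj_stab_def PB.subgroup_conj)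

text \<open>Relation (C) is the commutation needed in \<open>conj_in_crossing\<close>, with
  \<open>t\<close> the inverse of p_{b,c} in the first part and p_{b,c} itself in the
  second.\<close>

lemma conj_in_pgen_crossing:
  assumes "1 \<le> a" "a < b" "b < c" "c < d" "d \<le> n" and H: "subgroup H (PureBraid n)"
    and bc: "pgen n b c \<in> PB.conj_stab n H"
  shows "pgen n a b \<in> PB.conj_stab n H \<Longrightarrow> pgen n b d \<in> H \<Longrightarrow> PB.conj_in n (pgen n a c) (pgen n b d) H"
    and "pgen n c d \<in> PB.conj_stab n H \<Longrightarrow> pgen n a c \<in> H \<Longrightarrow> PB.conj_in n (pgen n b d) (pgen n a c) H"
proof -
  note Hc = subgroup.subset [OF H]
  note N = PB.conj_stab_subgroup [OF Hc]
  have [simp]: "pgen n a c \<in> carrier (PureBraid n)" "pgen n b d \<in> carrier (PureBraid n)"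
    "pgen n b c \<in> carrier (PureBraid n)"
    using assms by (auto intro: pgen_carrier)
  note C = pgen_crossing [OF assms(1-5)]
  show "PB.conj_in n (pgen n a c) (pgen n b d) H"
    if ab: "pgen n a b \<in> PB.conj_stab n H" and bd: "pgen n b d \<in> H"
  proof (rule PB.conj_in_crossing [OF Hc _ bd])
    show "inv\<^bsub>PureBraid n\<^esub> pgen n b c \<in> PB.conj_stab n H"
      using bc by (rule subgroup.m_inv_closed [OF N])
    \<comment> \<open>The triangle is used inside the normaliser of \<open>H\<close>, not inside
      \<open>H\<close>: only the outer factor \<open>t\<close> has to be moved.\<close>
    have "PB.triangle n (pgen n a c) (pgen n b c) (pgen n a b)"
      using assms by (intro PB.triangle_rotate [OF pgen_triangle]) auto
    then show "PB.conj_in n (pgen n a c) (inv\<^bsub>PureBraid n\<^esub> pgen n b c) (PB.conj_stab n H)"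
      by (intro PB.conj_in_inv N PB.conj_in_triangle(1) [OF N _ bc ab]) simp_all
  qed (use C in simp_all)
  show "PB.conj_in n (pgen n b d) (pgen n a c) H"
    if cd: "pgen n c d \<in> PB.conj_stab n H" and ac: "pgen n a c \<in> H"
  proof (rule PB.conj_in_crossing [OF Hc _ ac bc])
    have "PB.triangle n (pgen n b d) (pgen n c d) (pgen n b c)"
      using assms by (intro PB.triangle_rotate [OF pgen_triangle]) auto
    then show "PB.conj_in n (pgen n b d) (pgen n b c) (PB.conj_stab n H)"
      by (rule PB.conj_in_triangle(2) [OF N _ cd bc])
    let ?v = "pgen n a c" and ?w = "pgen n b c" and ?y = "pgen n b d"
    let ?m = "monoid.mult (PureBraid n)" and ?i = "m_inv (PureBraid n)"
    \<comment> \<open>Conjugating relation (C) by p_{b,c} turns it into the commutation of p_{b,d}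
      with the conjugate of p_{a,c}.\<close>
    have "?m ?y (?m (?m ?w ?v) (?i ?w)) = ?m ?w (?m (?m (?m (?m (?i ?w) ?y) ?w) ?v) (?i ?w))"
      by (simp add: PB.m_assoc)
    also have "\<dots> = ?m (?m (?m ?w ?v) (?i ?w)) ?y"
      unfolding C [symmetric] by (simp add: PB.m_assoc)
    finally show "?m ?y (?m (?m ?w ?v) (?i ?w)) = ?m (?m (?m ?w ?v) (?i ?w)) ?y" .
  qed simp
qed

lemma conj_in_pgen_triangle:
  assumes "1 \<le> a" "a < b" "b < c" "c \<le> n" and H: "subgroup H (PureBraid n)"
  shows "pgen n a c \<in> H \<Longrightarrow> pgen n b c \<in> H \<Longrightarrow>
      PB.conj_in n (pgen n a b) (pgen n a c) H \<and> PB.conj_in n (pgen n a b) (pgen n b c) H"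
    and "pgen n a b \<in> H \<Longrightarrow> pgen n b c \<in> H \<Longrightarrow>
      PB.conj_in n (pgen n a c) (pgen n a b) H \<and> PB.conj_in n (pgen n a c) (pgen n b c) H"
    and "pgen n a b \<in> H \<Longrightarrow> pgen n a c \<in> H \<Longrightarrow>
      PB.conj_in n (pgen n b c) (pgen n a b) H \<and> PB.conj_in n (pgen n b c) (pgen n a c) H"
proof -
  note T = pgen_triangle [OF assms(1-4)]
  note T' = PB.triangle_rotate [OF T]
  note T'' = PB.triangle_rotate [OF T']
  show "pgen n a c \<in> H \<Longrightarrow> pgen n b c \<in> H \<Longrightarrow>
      PB.conj_in n (pgen n a b) (pgen n a c) H \<and> PB.conj_in n (pgen n a b) (pgen n b c) H"
    using PB.conj_in_triangle [OF H T] by blast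
  show "pgen n a b \<in> H \<Longrightarrow> pgen n b c \<in> H \<Longrightarrow>
      PB.conj_in n (pgen n a c) (pgen n a b) H \<and> PB.conj_in n (pgen n a c) (pgen n b c) H"
    using PB.conj_in_triangle [OF H T'] by blast
  show "pgen n a b \<in> H \<Longrightarrow> pgen n a c \<in> H \<Longrightarrow>
      PB.conj_in n (pgen n b c) (pgen n a b) H \<and> PB.conj_in n (pgen n b c) (pgen n a c) H"
    using PB.conj_in_triangle [OF H T''] by blast
qed

lemma conj_in_pgen_commute:
  assumes "1 \<le> a" "a < b" "b < c" "c < d" "d \<le> n"
  shows "pgen n c d \<in> H \<Longrightarrow> PB.conj_in n (pgen n a b) (pgen n c d) H"
    and "pgen n a b \<in> H \<Longrightarrow> PB.conj_in n (pgen n c d) (pgen n a b) H"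
    and "pgen n b c \<in> H \<Longrightarrow> PB.conj_in n (pgen n a d) (pgen n b c) H"
    and "pgen n a d \<in> H \<Longrightarrow> PB.conj_in n (pgen n b c) (pgen n a d) H"
proof -
  have "pgen n a b \<in> carrier (PureBraid n)" "pgen n c d \<in> carrier (PureBraid n)"
    "pgen n a d \<in> carrier (PureBraid n)" "pgen n b c \<in> carrier (PureBraid n)"
    using assms by (auto intro: pgen_carrier)
  then show "pgen n c d \<in> H \<Longrightarrow> PB.conj_in n (pgen n a b) (pgen n c d) H"
    and "pgen n a b \<in> H \<Longrightarrow> PB.conj_in n (pgen n c d) (pgen n a b) H"
    and "pgen n b c \<in> H \<Longrightarrow> PB.conj_in n (pgen n a d) (pgen n b c) H"
    and "pgen n a d \<in> H \<Longrightarrow> PB.conj_in n (pgen n b c) (pgen n a d) H"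
    using pgen_commute [OF assms] by (simp_all add: PB.conj_in_commute)
qed

lemma Qsub_subgroup: "subgroup (Qsub n S) (PureBraid n)"
  unfolding Qsub_def by (intro PB.generate_is_subgroup) (auto intro: pgen_carrier)

lemma Psub_subgroup: "subgroup (Psub n S) (PureBraid n)"
  unfolding Psub_def by (intro PB.generate_is_subgroup) (auto intro: pgen_carrier)

lemma pgen_Qsub:
  "1 \<le> a \<Longrightarrow> a < b \<Longrightarrow> b \<le> n \<Longrightarrow> a \<in> S \<or> b \<in> S \<Longrightarrow> pgen n a b \<in> Qsub n S"
  unfolding Qsub_def by (intro generate.incl) blast

lemma pgen_Psub:
  "1 \<le> a \<Longrightarrow> a < b \<Longrightarrow> b \<le> n \<Longrightarrow> a \<in> S \<Longrightarrow> b \<in> S \<Longrightarrow> pgen n a b \<in> Psub n S"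
  unfolding Psub_def by (intro generate.incl) blast

text \<open>If \<open>k\<close> is an end of the middle arc \<open>p\<^bsub>b,c\<^esub>\<close>, that arc lies in \<open>Q\<^bsub>{k}\<^esub>\<close>. Otherwise use the smaller
  subgroup on three generators, which the arcs needed visibly normalise: for \<open>Q\<^bsub>{k}\<^esub>\<close> itself this
  is not yet known.\<close>

lemma conj_in_pgen_crossing_Qsub:
  assumes "1 \<le> a" "a < b" "b < c" "c < d" "d \<le> n"
  shows "k \<in> {b, d} \<Longrightarrow> PB.conj_in n (pgen n a c) (pgen n b d) (Qsub n {k})"
    and "k \<in> {a, c} \<Longrightarrow> PB.conj_in n (pgen n b d) (pgen n a c) (Qsub n {k})"
proof -
  let ?p = "pgen n"
  have carr: "?p a b \<in> carrier (PureBraid n)" "?p a c \<in> carrier (PureBraid n)"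
    "?p a d \<in> carrier (PureBraid n)" "?p b c \<in> carrier (PureBraid n)"
    "?p b d \<in> carrier (PureBraid n)" "?p c d \<in> carrier (PureBraid n)"
    using assms by (auto intro: pgen_carrier)
  note Q = Qsub_subgroup and stab = subset_conj_stab [OF Qsub_subgroup, THEN subsetD]
  have d: "PB.conj_in n (?p a c) (?p b d) (Qsub n {d})"
  proof (rule PB.conj_in_mono)
    let ?Y = "{?p a d, ?p b d, ?p c d}"
    have Y: "?Y \<subseteq> carrier (PureBraid n)" using carr by auto
    note H = PB.generate_is_subgroup [OF Y]
    have mem: "?p a d \<in> generate (PureBraid n) ?Y" "?p b d \<in> generate (PureBraid n) ?Y"
      "?p c d \<in> generate (PureBraid n) ?Y"
      by (auto intro: generate.incl)
    have "?p a b \<in> PB.conj_stab n (generate (PureBraid n) ?Y)"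
      \<comment> \<open>The triangle on a, b, d handles p_{a,d} and p_{b,d}, while p_{c,d} commutes
        with p_{a,b}.\<close>
      using assms mem conj_in_pgen_triangle(1) [OF _ _ _ _ H, of a b d] conj_in_pgen_commute(1) [OF assms]
      by (intro PB.conj_stab_generateI [OF Y carr(1)]) auto
    moreover have "?p b c \<in> PB.conj_stab n (generate (PureBraid n) ?Y)"
      using assms mem conj_in_pgen_triangle(1) [OF _ _ _ _ H, of b c d] conj_in_pgen_commute(4) [OF assms]
      by (intro PB.conj_stab_generateI [OF Y carr(4)]) auto
    ultimately show "PB.conj_in n (?p a c) (?p b d) (generate (PureBraid n) ?Y)"
      using conj_in_pgen_crossing(1) [OF assms H] mem by blast
    show "generate (PureBraid n) ?Y \<subseteq> Qsub n {d}"
      using assms by (intro PB.generate_subgroup_incl Q) (auto intro: pgen_Qsub)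
  qed
  have a: "PB.conj_in n (?p b d) (?p a c) (Qsub n {a})"
  proof (rule PB.conj_in_mono)
    let ?Y = "{?p a b, ?p a c, ?p a d}"
    have Y: "?Y \<subseteq> carrier (PureBraid n)" using carr by auto
    note H = PB.generate_is_subgroup [OF Y]
    have mem: "?p a b \<in> generate (PureBraid n) ?Y" "?p a c \<in> generate (PureBraid n) ?Y"
      "?p a d \<in> generate (PureBraid n) ?Y"
      by (auto intro: generate.incl)
    have "?p b c \<in> PB.conj_stab n (generate (PureBraid n) ?Y)"
      using assms mem conj_in_pgen_triangle(3) [OF _ _ _ _ H, of a b c] conj_in_pgen_commute(4) [OF assms]
      by (intro PB.conj_stab_generateI [OF Y carr(4)]) auto
    moreover have "?p c d \<in> PB.conj_stab n (generate (PureBraid n) ?Y)"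
      using assms mem conj_in_pgen_triangle(3) [OF _ _ _ _ H, of a c d] conj_in_pgen_commute(2) [OF assms]
      by (intro PB.conj_stab_generateI [OF Y carr(6)]) auto
    ultimately show "PB.conj_in n (?p b d) (?p a c) (generate (PureBraid n) ?Y)"
      using conj_in_pgen_crossing(2) [OF assms H] mem by blast
    show "generate (PureBraid n) ?Y \<subseteq> Qsub n {a}"
      using assms by (intro PB.generate_subgroup_incl Q) (auto intro: pgen_Qsub)
  qed
  have "PB.conj_in n (?p a c) (?p b d) (Qsub n {b})"
    using assms by (intro conj_in_pgen_crossing(1) Q stab) (auto intro: pgen_Qsub)
  then show "k \<in> {b, d} \<Longrightarrow> PB.conj_in n (?p a c) (?p b d) (Qsub n {k})"
    using d by auto
  have "PB.conj_in n (?p b d) (?p a c) (Qsub n {c})"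
    using assms by (intro conj_in_pgen_crossing(2) Q stab) (auto intro: pgen_Qsub)
  then show "k \<in> {a, c} \<Longrightarrow> PB.conj_in n (?p b d) (?p a c) (Qsub n {k})"
    using a by auto
qed

text \<open>A case analysis on how the endpoints interleave. A single strand \<open>k\<close>
  suffices, since a generator of \<open>Qsub n S\<close> needs only one end in
  \<open>S\<close>.\<close>

lemma conj_in_pgen_Qsub:
  assumes ab: "1 \<le> a" "a < b" "b \<le> n" and cd: "1 \<le> c" "c < d" "d \<le> n" and k: "k \<in> {a, b}"
  shows "PB.conj_in n (pgen n c d) (pgen n a b) (Qsub n {k})"
proof -
  note Q = Qsub_subgroup [of n "{k}"] and mem = pgen_Qsub [where S = "{k}"]
  consider "k \<in> {c, d}" | "k \<notin> {c, d}" "a \<in> {c, d} \<or> b \<in> {c, d}"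
    | "a \<noteq> c" "a \<noteq> d" "b \<noteq> c" "b \<noteq> d" by blast
  then show ?thesis
  proof cases
    case 1
    then show ?thesis
      using assms by (intro PB.subgroup_conj Q mem) auto
  next
    case 2
    \<comment> \<open>The arcs share exactly one endpoint and \<open>k\<close> is the other end of
      p_{a,b}. The two sides at \<open>k\<close> of the triangle on the three endpoints lie in
      \<open>Qsub n {k}\<close>, so relation (A) applies.\<close>
    then consider "a = c" "k = b" "b < d" | "a = c" "k = b" "d < b" | "a = d" "k = b"
      | "b = c" "k = a" | "b = d" "k = a" "a < c" | "b = d" "k = a" "c < a"
      using k assms by (auto simp: neq_iff)
    then show ?thesis
    proof cases
      case 1 then show ?thesis
        using assms conj_in_pgen_triangle(2) [OF _ _ _ _ Q, of a b d] mem by auto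
    next
      case 2 then show ?thesis
        using assms conj_in_pgen_triangle(1) [OF _ _ _ _ Q, of a d b] mem by auto
    next
      case 3 then show ?thesis
        using assms conj_in_pgen_triangle(1) [OF _ _ _ _ Q, of c a b] mem by auto
    next
      case 4 then show ?thesis
        using assms conj_in_pgen_triangle(3) [OF _ _ _ _ Q, of a b d] mem by auto
    next
      case 5 then show ?thesis
        using assms conj_in_pgen_triangle(3) [OF _ _ _ _ Q, of a c b] mem by auto
    next
      case 6 then show ?thesis
        using assms conj_in_pgen_triangle(2) [OF _ _ _ _ Q, of c a b] mem by auto
    qed
  next
    case 3
    have m: "pgen n a b \<in> Qsub n {k}" using assms by (intro mem) auto
    \<comment> \<open>With four distinct endpoints, separated or nested arcs commute by (B); the
      last two cases are the interlaced ones, governed by (C).\<close>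
    from 3 consider "b < c" | "d < a" | "a < c" "d < b" | "c < a" "b < d"
      | "a < c" "c < b" "b < d" | "c < a" "a < d" "d < b"
      using assms by linarith
    then show ?thesis
    proof cases
      case 1 then show ?thesis using assms m by (intro conj_in_pgen_commute(2)) auto
    next
      case 2 then show ?thesis using assms m by (intro conj_in_pgen_commute(1)) auto
    next
      case 3 then show ?thesis using assms m by (intro conj_in_pgen_commute(4)) auto
    next
      case 4 then show ?thesis using assms m by (intro conj_in_pgen_commute(3)) auto
    next
      case 5 then show ?thesis using assms by (intro conj_in_pgen_crossing_Qsub(2)) auto
    next
      case 6 then show ?thesis using assms by (intro conj_in_pgen_crossing_Qsub(1)) auto
    qed
  qed
qed

lemma Qsub_mono: "S \<subseteq> T \<Longrightarrow> Qsub n S \<subseteq> Qsub n T"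
  unfolding Qsub_def by (intro PB.mono_generate) auto

text \<open>This is the normality of \<open>Qsub n S\<close>: its normaliser is a subgroup
  containing all generators.\<close>

lemma conj_stab_Qsub: "PB.conj_stab n (Qsub n S) = carrier (PureBraid n)"
proof
  note N = PB.conj_stab_subgroup [OF subgroup.subset [OF Qsub_subgroup [of n S]]]
  show "PB.conj_stab n (Qsub n S) \<subseteq> carrier (PureBraid n)"
    using N by (rule subgroup.subset)
  have "pgen n c d \<in> PB.conj_stab n (Qsub n S)" if cd: "1 \<le> c" "c < d" "d \<le> n" for c d
    unfolding Qsub_def
  proof (rule PB.conj_stab_generateI; (unfold Qsub_def [symmetric])?)
    fix y assume "y \<in> {pgen n a b |a b. 1 \<le> a \<and> a < b \<and> b \<le> n \<and> (a \<in> S \<or> b \<in> S)}"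
    then obtain a b k where "y = pgen n a b" "1 \<le> a" "a < b" "b \<le> n" "k \<in> {a, b}" "k \<in> S"
      by blast
    then show "PB.conj_in n (pgen n c d) y (Qsub n S)"
      using conj_in_pgen_Qsub [of a b n c d k] cd
      by (auto intro: PB.conj_in_mono [OF _ Qsub_mono])
  qed (use cd pgen_carrier in auto)
  then have "Psub n {1..n} \<subseteq> PB.conj_stab n (Qsub n S)"
    unfolding Psub_def by (intro PB.generate_subgroup_incl N) auto
  then show "carrier (PureBraid n) \<subseteq> PB.conj_stab n (Qsub n S)"
    using carrier_subset_Psub by blast
qed

section \<open>Forgetting strands, as a retraction\<close>

definition forget_word :: "nat set \<Rightarrow> word \<Rightarrow> word" where
  "forget_word T = filter (\<lambda>(e, a, b). a \<in> T \<and> b \<in> T)"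

lemma forget_word_simps [simp]:
  "forget_word T [] = []"
  "forget_word T (u @ v) = forget_word T u @ forget_word T v"
  "forget_word T ((e, a, b) # w) = (if a \<in> T \<and> b \<in> T then [(e, a, b)] else []) @ forget_word T w"
  by (auto simp: forget_word_def)

lemma valid_forget_word: "valid_word n w \<Longrightarrow> valid_word n (forget_word T w)"
  by (auto simp: valid_word_def forget_word_def)

text \<open>If an index of the relation is lost, both sides of (A) or (B) become the same word. In
  (C) the same happens, except that losing only d leaves an inverse pair of p_{b,c} to
  cancel.\<close>

lemma forget_word_rel:
  assumes "braid_rel n r s"
  shows "braid_eq n (forget_word T r) (forget_word T s)"
proof -
  have rel: "braid_eq n r s"
    using braid_eq.rel [OF assms, of "[]" "[]"] by simp
  have cancel: "braid_eq n (u @ [(True, b, c), (False, b, c)] @ v) (u @ v)" for u v b c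
    using braid_eq.cancel [of n u "(True, b, c)" v] by simp
  show ?thesis
    using assms
  proof cases
    case (relC a b c d)
    show ?thesis
      using rel cancel [of "[(False, a, c)]" b c "[]"] cancel [of "[]" b c "[(False, a, c)]"]
        cancel [of "[]" b c "[]"]
      by (auto simp: relC gen_def geninv_def intro: braid_eq.refl braid_eq.trans braid_eq.sym)
  qed (use rel in \<open>auto simp: gen_def intro: braid_eq.refl\<close>)
qed

lemma forget_word_cong:
  assumes "braid_eq n u v"
  shows "braid_eq n (forget_word T u) (forget_word T v)"
  using assms
proof (induction rule: braid_eq.induct)
  case (cancel u l v)
  show ?case
    using braid_eq.cancel [of n "forget_word T u" l "forget_word T v"]
    by (cases l) (auto intro: braid_eq.refl)
next
  case (rel r s u v)
  then show ?case
    by (simp add: braid_eq_append_cong forget_word_rel braid_eq.refl)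
qed (blast intro: braid_eq.intros)+

definition forget :: "nat \<Rightarrow> nat set \<Rightarrow> word set \<Rightarrow> word set" where
  "forget n T x = braid_class n (forget_word T (SOME w. w \<in> x))"

lemma forget_braid_class:
  "valid_word n w \<Longrightarrow> forget n T (braid_class n w) = braid_class n (forget_word T w)"
  unfolding forget_def
  by (simp add: braid_class_eq_iff valid_forget_word forget_word_cong braid_class_some braid_eq.sym)

lemma forget_hom: "group_hom (PureBraid n) (PureBraid n) (forget n T)"
  by unfold_locales
    (auto simp: hom_def forget_braid_class braid_class_mult braid_class_carrier valid_forget_word
      elim!: carrier_PureBraidE)

lemma forget_pgen:
  assumes "1 \<le> a" "a < b" "b \<le> n"
  shows "forget n T (pgen n a b) = (if a \<in> T \<and> b \<in> T then pgen n a b else \<one>\<^bsub>PureBraid n\<^esub>)"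
  using assms by (simp add: pgen_def forget_braid_class one_PureBraid gen_def valid_letter_def)

text \<open>Both claims are checked on generators. The first makes \<open>forget n T\<close> a
  retraction onto \<open>Psub n T\<close>; the second serves to intersect two such
  subgroups.\<close>

lemma forget_Psub:
  assumes "x \<in> Psub n S"
  shows "S \<subseteq> T \<Longrightarrow> forget n T x = x" and "forget n T x \<in> Psub n (S \<inter> T)"
proof -
  interpret group_hom "PureBraid n" "PureBraid n" "forget n T" by (rule forget_hom)
  let ?Y = "{pgen n a b | a b. 1 \<le> a \<and> a < b \<and> b \<le> n \<and> a \<in> S \<and> b \<in> S}"
  have Y: "?Y \<subseteq> carrier (PureBraid n)" by (auto intro: pgen_carrier)
  have gen: "(S \<subseteq> T \<longrightarrow> forget n T h = h) \<and> forget n T h \<in> Psub n (S \<inter> T)" if h: "h \<in> ?Y" for h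
  proof -
    obtain a b where ab: "h = pgen n a b" "1 \<le> a" "a < b" "b \<le> n" "a \<in> S" "b \<in> S"
      using h by blast
    then have "forget n T h = (if a \<in> T \<and> b \<in> T then h else \<one>\<^bsub>PureBraid n\<^esub>)"
      by (simp add: forget_pgen)
    moreover have "h \<in> Psub n (S \<inter> T)" if "a \<in> T" "b \<in> T"
      using ab that pgen_Psub [of a b n "S \<inter> T"] by simp
    ultimately show ?thesis
      using ab subgroup.one_closed [OF Psub_subgroup [of n "S \<inter> T"]] by (simp add: subset_iff)
  qed
  have "(S \<subseteq> T \<longrightarrow> forget n T x = x) \<and> forget n T x \<in> Psub n (S \<inter> T)"
    using assms unfolding Psub_def [of n S]
  proof (induction rule: generate.induct)
    case one
    then show ?case by (simp add: subgroup.one_closed [OF Psub_subgroup])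
  next
    case (incl h)
    then show ?case by (rule gen)
  next
    case (inv h)
    then have "forget n T (inv\<^bsub>PureBraid n\<^esub> h) = inv\<^bsub>PureBraid n\<^esub> forget n T h"
      using Y by (intro hom_inv) blast
    then show ?case
      using gen [OF inv] by (simp add: subgroup.m_inv_closed [OF Psub_subgroup])
  next
    case (eng h1 h2)
    then have "h1 \<in> carrier (PureBraid n)" "h2 \<in> carrier (PureBraid n)"
      using PB.generate_in_carrier [OF Y] by blast+
    with eng.IH show ?case
      by (simp add: subgroup.m_closed [OF Psub_subgroup])
  qed
  then show "S \<subseteq> T \<Longrightarrow> forget n T x = x" and "forget n T x \<in> Psub n (S \<inter> T)" by auto
qed

text \<open>Every generator of \<open>Qsub n S\<close> has an end outside \<open>T\<close>, hence
  lies in the kernel.\<close>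

lemma forget_Qsub:
  assumes "x \<in> Qsub n S" "S \<inter> T = {}"
  shows "forget n T x = \<one>\<^bsub>PureBraid n\<^esub>"
proof -
  interpret group_hom "PureBraid n" "PureBraid n" "forget n T" by (rule forget_hom)
  have "Qsub n S \<subseteq> kernel (PureBraid n) (PureBraid n) (forget n T)"
    unfolding Qsub_def
  proof (intro PB.generate_subgroup_incl subgroup_kernel subsetI)
    fix h assume "h \<in> {pgen n a b | a b. 1 \<le> a \<and> a < b \<and> b \<le> n \<and> (a \<in> S \<or> b \<in> S)}"
    then obtain a b where "h = pgen n a b" "1 \<le> a" "a < b" "b \<le> n" "\<not> (a \<in> T \<and> b \<in> T)"
      using assms(2) by blast
    then show "h \<in> kernel (PureBraid n) (PureBraid n) (forget n T)"
      using pgen_carrier [of a b n] by (simp add: kernel_def forget_pgen del: de_Morgan_conj)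
  qed
  then show ?thesis
    using assms(1) by (auto simp: kernel_def)
qed

text \<open>Forgetting the strands in \<open>S\<close> fixes the first subgroup and kills the
  second. The complement \<open>- S\<close> is taken in all natural numbers; the index bounds on
  generators make it act like N - S.\<close>

lemma Psub_Int_Qsub: "Psub n (- S) \<inter> Qsub n S \<subseteq> {\<one>\<^bsub>PureBraid n\<^esub>}"
  using forget_Psub(1) [of _ n "- S" "- S"] forget_Qsub [of _ n S "- S"] by auto

text \<open>An \<open>x\<close> in both subgroups is fixed by \<open>forget n T\<close>, whose value
  on \<open>Psub n S\<close> lies in \<open>Psub n (S \<inter> T)\<close>.\<close>

lemma Psub_Int: "Psub n S \<inter> Psub n T \<subseteq> Psub n (S \<inter> T)"
proof
  fix x assume "x \<in> Psub n S \<inter> Psub n T"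
  then show "x \<in> Psub n (S \<inter> T)"
    using forget_Psub(1) [of x n T T] forget_Psub(2) [of x n S T] by simp
qed

section \<open>Supports\<close>

lemma Psub_mono: "S \<subseteq> T \<Longrightarrow> Psub n S \<subseteq> Psub n T"
  unfolding Psub_def by (intro PB.mono_generate) auto

lemma Psub_Int_atLeastAtMost: "Psub n (S \<inter> {1..n}) = Psub n S"
  unfolding Psub_def
  by (intro arg_cong [of _ _ "generate (PureBraid n)"] Collect_cong ex_cong1) auto

text \<open>The sets intersected in \<open>support\<close> form a finite nonempty family closed
  under intersection, so the support is itself a member, the least one.\<close>

lemma Psub_support:
  assumes "x \<in> carrier (PureBraid n)"
  shows "x \<in> Psub n (support n x)"
proof -
  define F where "F = {S. S \<subseteq> {1..n} \<and> x \<in> Psub n S}"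
  have "finite F"
    by (rule finite_subset [of _ "Pow {1..n}"]) (auto simp: F_def)
  moreover have "{1..n} \<in> F"
    using assms carrier_subset_Psub by (auto simp: F_def)
  moreover have "x \<in> Psub n (\<Inter>E)" if "finite E" "E \<noteq> {}" "E \<subseteq> F" for E
    using that
  proof (induction rule: finite_ne_induct)
    case (insert S E)
    then show ?case using Psub_Int [of n S "\<Inter>E"] by (auto simp: F_def)
  qed (auto simp: F_def)
  ultimately have "x \<in> Psub n (\<Inter>F)"
    by blast
  then show ?thesis
    by (simp add: support_def F_def)
qed

lemma support_disjoint_iff:
  assumes "x \<in> carrier (PureBraid n)"
  shows "support n x \<inter> S = {} \<longleftrightarrow> x \<in> Psub n (- S)"
proof
  assume "support n x \<inter> S = {}"
  then show "x \<in> Psub n (- S)"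
    using Psub_support [OF assms] Psub_mono [of "support n x" "- S" n] by blast
next
  assume "x \<in> Psub n (- S)"
  \<comment> \<open>Only subsets of \<open>{1..n}\<close> enter the definition of the support, so
    \<open>- S\<close> has to be cut down first.\<close>
  then have "x \<in> Psub n (- S \<inter> {1..n})"
    by (simp only: Psub_Int_atLeastAtMost)
  then show "support n x \<inter> S = {}"
    unfolding support_def by blast
qed

section \<open>Monic commutators and the generation theorem\<close>

lemma comm_closed:
  "x \<in> carrier (PureBraid n) \<Longrightarrow> y \<in> carrier (PureBraid n) \<Longrightarrow> comm n x y \<in> carrier (PureBraid n)"
  by (simp add: comm_def)

lemma comm_inv:
  "x \<in> carrier (PureBraid n) \<Longrightarrow> y \<in> carrier (PureBraid n) \<Longrightarrow>
    inv\<^bsub>PureBraid n\<^esub> comm n x y = comm n y x"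
  by (simp add: comm_def PB.inv_mult_group PB.m_assoc)

text \<open>By normality, [x,y] is the product of the inverse of \<open>x\<close> and a conjugate of
  \<open>x\<close>, both in \<open>Qsub n S\<close>; [y,x] is its inverse.\<close>

lemma comm_Qsub:
  assumes "x \<in> Qsub n S" "y \<in> carrier (PureBraid n)"
  shows "comm n x y \<in> Qsub n S" "comm n y x \<in> Qsub n S"
proof -
  note Q = Qsub_subgroup [of n S]
  have x: "x \<in> carrier (PureBraid n)" using assms subgroup.mem_carrier [OF Q] by blast
  have "inv\<^bsub>PureBraid n\<^esub> y \<otimes>\<^bsub>PureBraid n\<^esub> x \<otimes>\<^bsub>PureBraid n\<^esub> y \<in> Qsub n S"
    using assms conj_stab_Qsub [of n S] by (auto simp: PB.conj_stab_def PB.conj_in_def)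
  then have "inv\<^bsub>PureBraid n\<^esub> x \<otimes>\<^bsub>PureBraid n\<^esub> (inv\<^bsub>PureBraid n\<^esub> y \<otimes>\<^bsub>PureBraid n\<^esub> x \<otimes>\<^bsub>PureBraid n\<^esub> y) \<in> Qsub n S"
    using subgroup.m_closed [OF Q] subgroup.m_inv_closed [OF Q] assms by blast
  then show *: "comm n x y \<in> Qsub n S"
    using assms x by (simp add: comm_def PB.m_assoc)
  then show "comm n y x \<in> Qsub n S"
    using subgroup.m_inv_closed [OF Q *] comm_inv x assms by simp
qed

lemma monic_carrier: "x \<in> monic n \<Longrightarrow> x \<in> carrier (PureBraid n)"
  by (induction rule: monic.induct) (simp_all add: pgen_carrier comm_closed)

text \<open>The inverse of [x,y] is [y,x], which is nontrivial as well. This supplies the closure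
  under inverses required for collecting.\<close>

lemma monic_inv: "x \<in> monic n \<Longrightarrow> inv\<^bsub>PureBraid n\<^esub> x \<in> monic n"
proof (induction rule: monic.induct)
  case (comm_monic x y)
  then have "x \<in> carrier (PureBraid n)" "y \<in> carrier (PureBraid n)"
    by (auto intro: monic_carrier)
  with comm_monic show ?case
    using PB.inv_eq_1_iff comm_closed comm_inv by (metis monic.comm_monic)
qed (simp_all add: monic.intros pgen_carrier)

text \<open>If one entry of a commutator lies in the normal subgroup \<open>Qsub n S\<close>, so
  does the commutator; otherwise both entries lie in the subgroup
  \<open>Psub n (- S)\<close>.\<close>

lemma monic_dichotomy: "x \<in> monic n \<Longrightarrow> x \<in> Qsub n S \<or> x \<in> Psub n (- S)"
proof (induction rule: monic.induct)
  case (gen_monic a b)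
  then show ?case using pgen_Qsub [of a b n S] pgen_Psub [of a b n "- S"] by auto
next
  case (inv_monic a b)
  then show ?case
    using pgen_Qsub [of a b n S] pgen_Psub [of a b n "- S"] subgroup.m_inv_closed [OF Qsub_subgroup]
      subgroup.m_inv_closed [OF Psub_subgroup] by (meson Compl_iff)
next
  case (comm_monic x y)
  have "comm n x y \<in> Psub n (- S)" if "x \<in> Psub n (- S)" "y \<in> Psub n (- S)"
    unfolding comm_def using that
    by (intro subgroup.m_closed [OF Psub_subgroup] subgroup.m_inv_closed [OF Psub_subgroup])
  with comm_monic show ?case
    using comm_Qsub monic_carrier by blast
qed

theorem theorem2p1:
  fixes n m :: nat and S :: "nat \<Rightarrow> nat set"
  assumes "\<forall>i \<in> {1..m}. S i \<subseteq> {1..n}"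
  shows "carrier (PureBraid n) \<inter> (\<Inter> i \<in> {1..m}. Qsub n (S i)) =
         generate (PureBraid n)
           {x \<in> monic n. \<forall>i \<in> {1..m}. support n x \<inter> S i \<noteq> {}}"
proof -
  \<comment> \<open>The support condition is restated as non-membership, by
    \<open>support_disjoint_iff\<close>, and indexed by the number of sets for the
    induction.\<close>
  define A where "A m = {x \<in> monic n. \<forall>i\<in>{1..m}. x \<notin> Psub n (- S i)}" for m
  have A_eq: "A m = {x \<in> monic n. \<forall>i \<in> {1..m}. support n x \<inter> S i \<noteq> {}}"
    by (auto simp: A_def support_disjoint_iff monic_carrier)
  have A_carrier: "A m \<subseteq> carrier (PureBraid n)" for m
    by (auto simp: A_def monic_carrier)
  have A_Q: "x \<in> Qsub n (S i)" if "x \<in> A m" "i \<in> {1..m}" for x m i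
    using that monic_dichotomy [of x n "S i"] by (auto simp: A_def)
  have A_inv: "inv\<^bsub>PureBraid n\<^esub> x \<in> A m" if "x \<in> A m" for x m
  proof -
    have "x \<in> Psub n (- S i)" if "inv\<^bsub>PureBraid n\<^esub> x \<in> Psub n (- S i)" for i
      using subgroup.m_inv_closed [OF Psub_subgroup that] A_carrier \<open>x \<in> A m\<close>
      by (metis PB.inv_inv subsetD)
    then show ?thesis using that by (auto simp: A_def monic_inv)
  qed
  have A_comm: "comm n y z \<in> A m"
    if y: "y \<in> A m" and z: "z \<in> monic n" and nt: "comm n y z \<noteq> \<one>\<^bsub>PureBraid n\<^esub>" for y z m
  proof -
    have "comm n y z \<notin> Psub n (- S i)" if "i \<in> {1..m}" for i
      \<comment> \<open>The commutator inherits membership in \<open>Qsub n (S i)\<close> from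
        \<open>y\<close>; being nontrivial, it cannot also lie in
        \<open>Psub n (- S i)\<close>.\<close>
      using comm_Qsub(1) [OF A_Q [OF y that] monic_carrier [OF z]] nt Psub_Int_Qsub by blast
    moreover have "comm n y z \<in> monic n"
      using y z nt by (auto simp: A_def intro: monic.comm_monic)
    ultimately show ?thesis by (simp add: A_def)
  qed
  have "carrier (PureBraid n) \<inter> (\<Inter> i \<in> {1..m}. Qsub n (S i)) \<subseteq> generate (PureBraid n) (A m)"
  proof (induction m)
    case 0
    \<comment> \<open>With no sets the condition is empty, so \<open>A 0\<close> consists of all
      monic commutators, among them the generators.\<close>
    have "Psub n {1..n} \<subseteq> generate (PureBraid n) (A 0)"
      unfolding Psub_def by (rule PB.mono_generate) (auto simp: A_def intro: monic.intros)
    then show ?case using carrier_subset_Psub by auto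
  next
    case (Suc m)
    let ?P = "Psub n (- S (Suc m))" and ?Q = "Qsub n (S (Suc m))"
    have Suc_eq: "A m - ?P = A (Suc m)"
      by (auto simp: A_def atLeastAtMostSuc_conv)
    have "inv\<^bsub>PureBraid n\<^esub> z \<otimes>\<^bsub>PureBraid n\<^esub> y \<otimes>\<^bsub>PureBraid n\<^esub> z \<in> generate (PureBraid n) (A (Suc m))"
      if y: "y \<in> A (Suc m)" and z: "z \<in> A m" for y z
    proof -
      have "y \<in> carrier (PureBraid n)" "z \<in> carrier (PureBraid n)"
        using y z A_carrier by blast+
      \<comment> \<open>The identity y z = z y [y,z] in conjugation form.\<close>
      then have "inv\<^bsub>PureBraid n\<^esub> z \<otimes>\<^bsub>PureBraid n\<^esub> y \<otimes>\<^bsub>PureBraid n\<^esub> z = y \<otimes>\<^bsub>PureBraid n\<^esub> comm n y z"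
        by (simp add: comm_def PB.m_assoc)
      moreover have "comm n y z \<in> generate (PureBraid n) (A (Suc m))"
        \<comment> \<open>A trivial commutator is not produced by \<open>comm_monic\<close>, but the
          identity lies in every generated subgroup.\<close>
        using A_comm [OF y, of z] z generate.one [of "PureBraid n"]
        by (cases "comm n y z = \<one>\<^bsub>PureBraid n\<^esub>") (auto simp: A_def intro: generate.incl)
      ultimately show ?thesis
        using y by (simp add: generate.eng generate.incl)
    qed
    moreover have "A (Suc m) \<subseteq> ?Q" using A_Q by force
    ultimately have "generate (PureBraid n) (A m) \<inter> ?Q \<subseteq> generate (PureBraid n) (A (Suc m))"
      using PB.generate_Int_complement [OF A_carrier A_inv Psub_subgroup Qsub_subgroup Psub_Int_Qsub,
          of m "S (Suc m)"] by (simp add: Suc_eq)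
    then show ?case
      using Suc.IH by (auto simp: atLeastAtMostSuc_conv)
  qed
  \<comment> \<open>The reverse inclusion only needs the dichotomy: a monic commutator outside
    \<open>Psub n (- S i)\<close> lies in \<open>Qsub n (S i)\<close>.\<close>
  moreover have "generate (PureBraid n) (A m) \<subseteq> Qsub n (S i)" if "i \<in> {1..m}" for i
    using that by (intro PB.generate_subgroup_incl Qsub_subgroup) (auto intro: A_Q)
  moreover have "generate (PureBraid n) (A m) \<subseteq> carrier (PureBraid n)"
    by (rule PB.generate_incl [OF A_carrier])
  ultimately have "carrier (PureBraid n) \<inter> (\<Inter> i \<in> {1..m}. Qsub n (S i)) = generate (PureBraid n) (A m)"
    by (intro subset_antisym Int_greatest INT_greatest)
  then show ?thesis
    by (simp only: A_eq)
qed

end
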